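(* Let $(V,\mathcal{E})$ be a $3$-uniform hypergraph. If some two vertices of $(V,\mathcal{E})$ belong to more than one line, then $V$ contains four distinct vertices $p,q,r,s$ such that $\{p,q,r\}\in\mathcal{E}$, $\{p,q,s\}\in\mathcal{E}$ and $\{p,r,s\}\notin\mathcal{E}$.
   Context: A hypergraph is a pair $(V,\mathcal{E})$ with $\mathcal{E}$ a set of subsets of $V$ (hyperedges); it is $3$-uniform if every hyperedge has exactly three elements. For distinct vertices $u,v$ of a $3$-uniform hypergraph $(V,\mathcal{E})$, the line $\overline{uv}$ is the set consisting of $u$, $v$, and all vertices $w$ such that $\{u,v,w\}\in\mathcal{E}$. A "line" of the hypergraph is any set of the form $\overline{uv}$ with $u\neq v$. *)

theory Defs
  imports Main
begin

definition hypergraph :: "'a set \<Rightarrow> 'a set set \<Rightarrow> bool" where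
  "hypergraph V \<E> \<longleftrightarrow> (\<forall>e\<in>\<E>. e \<subseteq> V)"

definition uniform :: "nat \<Rightarrow> 'a set set \<Rightarrow> bool" where
  "uniform k \<E> \<longleftrightarrow> (\<forall>e\<in>\<E>. finite e \<and> card e = k)"

definition line :: "'a set \<Rightarrow> 'a set set \<Rightarrow> 'a \<Rightarrow> 'a \<Rightarrow> 'a set" where
  "line V \<E> u v = {u, v} \<union> {w \<in> V. {u, v, w} \<in> \<E>}"

definition lines :: "'a set \<Rightarrow> 'a set set \<Rightarrow> 'a set set" where
  "lines V \<E> = {line V \<E> u v | u v. u \<in> V \<and> v \<in> V \<and> u \<noteq> v}"

end

(* If no such p, q, r, s exist, then replacing one of the two points generating a line by any
   other point of the line does not change it; two replacements turn the line uv into the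
   line xy for any distinct x, y on it, so two points determine a unique line. *)
theory Submission
  imports Defs
begin

lemma line_commute: "line V \<E> u v = line V \<E> v u"
  unfolding line_def by (simp add: insert_commute)

text \<open>This is the negation of the conclusion of the theorem. By the symmetry of
  \<open>p\<close> and \<open>q\<close>, it means that four distinct vertices carrying two edges
  carry all four possible ones.\<close>

definition edge_exchange :: "'a set \<Rightarrow> 'a set set \<Rightarrow> bool" where
  "edge_exchange V \<E> \<longleftrightarrow> (\<forall>p\<in>V. \<forall>q\<in>V. \<forall>r\<in>V. \<forall>s\<in>V. distinct [p, q, r, s] \<longrightarrow>
     {p, q, r} \<in> \<E> \<longrightarrow> {p, q, s} \<in> \<E> \<longrightarrow> {p, r, s} \<in> \<E>)"

text \<open>For \<open>w\<close> other than \<open>v\<close>, a further point \<open>z\<close> of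
  the line yields two edges \<open>{u, v, w}\<close> and \<open>{u, v, z}\<close> sharing
  \<open>u\<close> and \<open>v\<close>, and the exchange property turns them into
  \<open>{u, w, z}\<close>.\<close>

lemma line_replace_subset:
  assumes "edge_exchange V \<E>"
    and "u \<in> V" "v \<in> V" "u \<noteq> v" "w \<in> line V \<E> u v" "w \<noteq> u"
  shows "line V \<E> u v \<subseteq> line V \<E> u w"
proof (cases "w = v")
  case False
  then have w: "w \<in> V" "{u, v, w} \<in> \<E>"
    using assms unfolding line_def by auto
  show ?thesis
  proof
    fix z assume z: "z \<in> line V \<E> u v"
    show "z \<in> line V \<E> u w"
    \<comment> \<open>The exchange property needs four distinct vertices, so the three points of the
      known edge are treated apart.\<close>
    proof (cases "z \<in> {u, v, w}")
      case True
      moreover have "{u, w, v} \<in> \<E>"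
        using w by (simp add: insert_commute)
      ultimately show ?thesis
        using assms unfolding line_def by auto
    next
      case z': False
      then have "z \<in> V" "{u, v, z} \<in> \<E>"
        using z unfolding line_def by auto
      moreover have "distinct [u, v, w, z]"
        using z' assms False by auto
      ultimately have "{u, w, z} \<in> \<E>"
        using assms(1-3) w unfolding edge_exchange_def by blast
      then show ?thesis
        using \<open>z \<in> V\<close> unfolding line_def by simp
    qed
  qed
qed simp

lemma line_replace:
  assumes "edge_exchange V \<E>"
    and "u \<in> V" "v \<in> V" "u \<noteq> v" "w \<in> line V \<E> u v" "w \<noteq> u"
  shows "line V \<E> u w = line V \<E> u v"
proof
  show sub: "line V \<E> u v \<subseteq> line V \<E> u w"
    using assms by (rule line_replace_subset)
  \<comment> \<open>Since \<open>v\<close> lies on the new line by \<open>sub\<close>, the inclusion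
    lemma applies again with \<open>v\<close> and \<open>w\<close> interchanged.\<close>
  have "w \<in> V" "v \<in> line V \<E> u w"
    using assms sub unfolding line_def by auto
  then show "line V \<E> u w \<subseteq> line V \<E> u v"
    using assms by (intro line_replace_subset) auto
qed

lemma line_eq_line:
  assumes "edge_exchange V \<E>"
    and "u \<in> V" "v \<in> V" "u \<noteq> v"
    and "x \<in> line V \<E> u v" "y \<in> line V \<E> u v" "x \<noteq> y"
  shows "line V \<E> x y = line V \<E> u v"
proof (cases "x = u")
  case True
  then show ?thesis
    using assms line_replace by metis
next
  case False
  have "x \<in> V"
    using assms unfolding line_def by auto
  \<comment> \<open>First \<open>x\<close> takes the place of \<open>v\<close>. With the generators
    swapped, \<open>u\<close> is the one that \<open>y\<close> replaces next; \<open>y\<close> is on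
    this line and differs from \<open>x\<close>.\<close>
  have ux: "line V \<E> x u = line V \<E> u v"
    using line_replace[OF assms(1-5) False] by (simp add: line_commute[of V \<E> x u])
  then show ?thesis
    using line_replace[OF assms(1) \<open>x \<in> V\<close> assms(2) False, of y] assms by simp
qed

theorem theorem1:
  fixes V :: "'a set" and \<E> :: "'a set set"
  assumes "hypergraph V \<E>"
    and "uniform 3 \<E>"
    and "\<exists>x\<in>V. \<exists>y\<in>V. x \<noteq> y \<and>
           (\<exists>L\<in>lines V \<E>. \<exists>L'\<in>lines V \<E>. L \<noteq> L' \<and> {x, y} \<subseteq> L \<and> {x, y} \<subseteq> L')"
  shows "\<exists>p\<in>V. \<exists>q\<in>V. \<exists>r\<in>V. \<exists>s\<in>V. distinct [p, q, r, s] \<and>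
           {p, q, r} \<in> \<E> \<and> {p, q, s} \<in> \<E> \<and> {p, r, s} \<notin> \<E>"
proof (rule ccontr)
  assume "\<not> ?thesis"
  then have exch: "edge_exchange V \<E>"
    unfolding edge_exchange_def by blast
  obtain x y L L' where "x \<noteq> y" and L: "L \<in> lines V \<E>" "L' \<in> lines V \<E>" "L \<noteq> L'"
    and xy: "{x, y} \<subseteq> L" "{x, y} \<subseteq> L'"
    using assms(3) by blast
  \<comment> \<open>Applied to both \<open>L\<close> and \<open>L'\<close>, this forces them to
    coincide.\<close>
  have "K = line V \<E> x y" if "K \<in> lines V \<E>" "{x, y} \<subseteq> K" for K
    using that line_eq_line[OF exch] \<open>x \<noteq> y\<close> unfolding lines_def by blast
  then show False
    using L xy by metis
qed

end
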